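(* Let $r\ge2$ be an integer. (1) For $x\in\mathbb C$ with $\operatorname{Im}(x)<0$, $$\mathcal C_r\left(\frac x{2}\right)=\exp\left(-\frac{(r-1)!}{(2\pi i)^{r-1}}\sum_{k=0}^{r-1}\frac{(\pi i)^k}{k!}\operatorname{Li}_{r-k}(-e^{-\pi ix})x^k+\frac{\pi i}{r}\left(\frac x2\right)^{r}-\frac{(r-1)!}{(2\pi i)^{r-1}}\zeta_E(r)\right).$$ (2) For $x\in\mathbb C$ with $\operatorname{Im}(x)>0$, $$\mathcal C_r\left(\frac x{2}\right)=\exp\left(-\frac{(r-1)!}{(-2\pi i)^{r-1}}\sum_{k=0}^{r-1}\frac{(-\pi i)^k}{k!}\operatorname{Li}_{r-k}(-e^{\pi ix})x^k-\frac{\pi i}{r}\left(\frac x2\right)^{r}-\frac{(r-1)!}{(-2\pi i)^{r-1}}\zeta_E(r)\right).$$ (3) If $r$ is even and $0\le x<1$ is real, then $$ \begin{aligned} \mathcal C_r\left(\frac x{2}\right)&=\left(2\cos\frac{\pi x}{2}\right)^{(\frac x2)^{r-1}} \exp\biggl((-1)^{\frac{r}{2}}\frac{(r-1)!}{(2\pi)^{r-1}}\sum_{\substack{1\leq k\leq r-3 \\ k\ \text{odd}}}\frac{(-1)^{\frac{k-1}2}(\pi x)^k}{k!}\sum_{n=1}^\infty \frac{(-1)^n\cos(\pi nx)}{n^{r-k}} \\ &\qquad-(-1)^{\frac{r}{2}}\frac{(r-1)!}{(2\pi)^{r-1}}\sum_{\substack{0\leq k\leq r-2 \\ k\ \text{even}}}\frac{(-1)^{\frac{k}2}(\pi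 x)^k}{k!}\sum_{n=1}^\infty \frac{(-1)^n\sin(\pi nx)}{n^{r-k}} \biggr). \end{aligned} $$ (4) If $r\ge3$ is odd and $0\le x<1$ is real, then $$ \begin{aligned} \mathcal C_r\left(\frac x{2}\right)&=\left(2\cos\frac{\pi x}{2}\right)^{(\frac x2)^{r-1}} \exp\biggl(-(-1)^{\frac{r-1}{2}}\frac{(r-1)!}{(2\pi)^{r-1}}\sum_{\substack{0\leq k\leq r-3 \\ k\ \text{even}}}\frac{(-1)^{\frac k2}(\pi x)^k}{k!}\sum_{n=1}^\infty \frac{(-1)^n\cos(\pi nx)}{n^{r-k}} \\ &\qquad-(-1)^{\frac{r-1}{2}}\frac{(r-1)!}{(2\pi)^{r-1}}\sum_{\substack{1\leq k\leq r-2 \\ k\ \text{odd}}}\frac{(-1)^{\frac{k-1}2}(\pi x)^k}{k!}\sum_{n=1}^\infty \frac{(-1)^n\sin(\pi nx)}{n^{r-k}} \\ &\qquad -(-1)^{\frac{r-1}2}\frac{(r-1)!}{(2\pi)^{r-1}}\zeta_E(r)\biggr). \end{aligned} $$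
   Context: For an integer $r\ge2$ let $P_r(y)=(1-y)\exp\left(y+\frac{y^2}{2}+\cdots+\frac{y^r}{r}\right)$. The multiple cosine function of Kurokawa–Koyama of order $r\ge2$ is $\mathcal C_r(x)=\prod_{n\ge1,\ n\text{ odd}}\left\{P_r\left(\frac{x}{n/2}\right)P_r\left(-\frac{x}{n/2}\right)^{(-1)^{r-1}}\right\}^{(n/2)^{r-1}}$, interpreted as $\mathcal C_r(x)=\exp\Big(\sum_{n\ge1,\,n\text{ odd}}(n/2)^{r-1}\big[\operatorname{Log}P_r(2x/n)+(-1)^{r-1}\operatorname{Log}P_r(-2x/n)\big]\Big)$, where $\operatorname{Log}P_r(y):=\operatorname{Log}(1-y)+y+\frac{y^2}{2}+\cdots+\frac{y^r}{r}$ with $\operatorname{Log}$ the principal branch. The series converges and defines a holomorphic function on $D=\mathbb C\setminus\big((-\infty,-\tfrac12]\cup[\tfrac12,\infty)\big)$ (which contains all non-real $x$), positive on $(-\tfrac12,\tfrac12)$. $\operatorname{Li}_k(z)=\sum_{n\ge1}z^n/n^k$ for $|z|<1$ is the polylogarithm, $\zeta_E(s)=\sum_{n=1}^\infty\frac{(-1)^{n+1}}{n^s}$. Empty sums are $0$. *)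

theory Defs
  imports "HOL-Analysis.Analysis"
begin

definition LogP :: "nat \<Rightarrow> complex \<Rightarrow> complex" where
  "LogP r y = Ln (1 - y) + (\<Sum>j=1..r. y ^ j / of_nat j)"

definition multicos :: "nat \<Rightarrow> complex \<Rightarrow> complex" where
  "multicos r x = exp (\<Sum>m. (of_nat (2*m+1) / 2) ^ (r - 1) *
      (LogP r (2 * x / of_nat (2*m+1)) + (-1) ^ (r - 1) * LogP r (- 2 * x / of_nat (2*m+1))))"

text \<open>Polylogarithm Li_k(z) = sum_{n>=1} z^n / n^k (used for |z| < 1).\<close>
definition polylog :: "nat \<Rightarrow> complex \<Rightarrow> complex" where
  "polylog k z = (\<Sum>n. z ^ (n+1) / of_nat (n+1) ^ k)"

definition zetaE :: "nat \<Rightarrow> real" where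
  "zetaE s = (\<Sum>n. (-1) ^ n / real (n+1) ^ s)"

end

theory Submission
  imports Defs
begin

text \<open>
  By the partial fraction expansion of the tangent, the series \<open>F\<close> defining the logarithm of the
  multiple cosine has derivative \<open>- \<pi> x\<^bsup>r-1\<^esup> tan (\<pi> x)\<close>, and \<open>F(0) = 0\<close>. In the lower half-plane
  the derivative of the polylogarithm sum telescopes, so that the exponent in (1) and \<open>F(x/2)\<close> have
  the same derivative and differ by a constant. Both extend continuously to the real interval
  \<open>(-1, 1)\<close>, where at \<open>x = 0\<close> the constant is seen to vanish because \<open>Li\<^sub>r(-1) = - \<zeta>\<^sub>E(r)\<close>.
  Complex conjugation turns (1) into (2) and shows that \<open>F\<close> is real on the interval, so (3) and (4)
  are the real part of the boundary version of (1).
\<close>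

subsection \<open>The partial fraction expansion of the tangent\<close>

lemma Digamma_diff_sums:
  fixes z w :: "'a :: {real_normed_field,banach}"
  assumes "z \<noteq> 0" "w \<noteq> 0"
  shows "(\<lambda>m. inverse (w + of_nat m) - inverse (z + of_nat m)) sums (Digamma z - Digamma w)"
proof -
  have "(\<lambda>m. inverse (of_nat (Suc m)) - inverse (y + of_nat m)) sums (Digamma y + euler_mascheroni)"
    if "y \<noteq> 0" for y :: 'a
    using summable_sums[OF summable_Digamma[OF that]] by (simp add: Digamma_def)
  from sums_diff[OF this[OF assms(1)] this[OF assms(2)]] show ?thesis by simp
qed

lemma Digamma_reflection_complex:
  fixes z :: complex
  assumes "z \<notin> \<int>"
  shows "Digamma (1 - z) - Digamma z = of_real pi * cot (of_real pi * z)"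
proof -
  define g where "g = Gamma z * Gamma (1 - z)"
  have nonpole: "z \<notin> \<int>\<^sub>\<le>\<^sub>0" "1 - z \<notin> \<int>\<^sub>\<le>\<^sub>0"
    using assms nonpos_Ints_subset_Ints Ints_diff[of 1 "1 - z"] by auto
  then have "g \<noteq> 0"
    by (simp add: g_def Gamma_eq_zero_iff)
  then have sin: "sin (of_real pi * z) \<noteq> 0"
    by (auto simp: g_def Gamma_reflection_complex)
  have "((\<lambda>y. Gamma y * Gamma (1 - y)) has_field_derivative g * (Digamma z - Digamma (1 - z))) (at z)"
    unfolding g_def using nonpole
    by (auto intro!: derivative_eq_intros simp: algebra_simps)
  moreover have "((\<lambda>y. Gamma y * Gamma (1 - y)) has_field_derivative
      - (g * (of_real pi * cot (of_real pi * z)))) (at z)"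
    unfolding g_def Gamma_reflection_complex using sin
    by (auto intro!: derivative_eq_intros simp: cot_def divide_simps)
  ultimately have "g * (Digamma z - Digamma (1 - z)) = - (g * (of_real pi * cot (of_real pi * z)))"
    by (rule DERIV_unique)
  then have "g * (Digamma (1 - z) - Digamma z) = g * (of_real pi * cot (of_real pi * z))"
    by (simp add: algebra_simps)
  with \<open>g \<noteq> 0\<close> show ?thesis
    by simp
qed

lemma tan_partial_fractions:
  fixes x :: complex
  assumes "x + 1/2 \<notin> \<int>"
  shows "(\<lambda>m. 2 * x / (of_real (real m + 1/2) ^ 2 - x ^ 2)) sums (of_real pi * tan (of_real pi * x))"
proof -
  have notin: "1/2 - x \<notin> \<int>"
    using assms Ints_diff[of 1 "1/2 - x"] by (auto simp: add.commute)
  have nonzero: "1/2 + x + of_nat m \<noteq> 0" "1/2 - x + of_nat m \<noteq> 0" for m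
    using assms notin by (metis add.commute plus_of_nat_eq_0_imp nonpos_Ints_Int)+
  have "Digamma (1/2 + x) - Digamma (1/2 - x) = of_real pi * cot (of_real pi / 2 - of_real pi * x)"
    using Digamma_reflection_complex[OF notin] by (simp add: right_diff_distrib)
  also have "cot (of_real pi / 2 - of_real pi * x) = tan (of_real pi * x)"
    by (simp add: cot_def tan_def sin_diff cos_diff)
  finally have "(\<lambda>m. inverse (1/2 - x + of_nat m) - inverse (1/2 + x + of_nat m)) sums
      (of_real pi * tan (of_real pi * x))"
    using Digamma_diff_sums[of "1/2 + x" "1/2 - x"] nonzero[of 0] by simp
  moreover have "inverse (1/2 - x + of_nat m) - inverse (1/2 + x + of_nat m) =
      2 * x / (of_real (real m + 1/2) ^ 2 - x ^ 2)" for m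
  proof -
    have "of_real (real m + 1/2) ^ 2 - x ^ 2 = (1/2 + x + of_nat m) * (1/2 - x + of_nat m)"
      by (simp add: algebra_simps power2_eq_square)
    then show ?thesis
      using nonzero[of m] by (simp only:) (simp add: divide_simps)
  qed
  ultimately show ?thesis
    by simp
qed

subsection \<open>The logarithm of the multiple cosine and its derivative\<close>

lemma LogP_0: "LogP r 0 = 0"
  by (auto simp: LogP_def power_0_left intro!: sum.neutral)

lemma cnj_LogP: "1 - y \<notin> \<real>\<^sub>\<le>\<^sub>0 \<Longrightarrow> cnj (LogP r y) = LogP r (cnj y)"
  by (simp add: LogP_def cnj_Ln)

lemma LogP_has_field_derivative:
  assumes "1 - y \<notin> \<real>\<^sub>\<le>\<^sub>0"
  shows "(LogP r has_field_derivative - (y ^ r / (1 - y))) (at y)"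
proof -
  have "y \<noteq> 1" using assms by auto
  have "(\<Sum>j=1..r. y ^ (j - 1)) = (\<Sum>j<r. y ^ j)"
    by (rule sum.reindex_bij_witness[of _ Suc "\<lambda>j. j - 1"]) auto
  also have "\<dots> = 1 / (1 - y) - y ^ r / (1 - y)"
    using \<open>y \<noteq> 1\<close> by (simp add: sum_gp_strict diff_divide_distrib)
  finally have geometric: "(\<Sum>j=1..r. y ^ (j - 1)) = 1 / (1 - y) - y ^ r / (1 - y)" .
  have "((\<lambda>y. \<Sum>j=1..r. y ^ j / of_nat j) has_field_derivative (\<Sum>j=1..r. y ^ (j - 1))) (at y)"
    by (rule DERIV_sum) (auto intro!: derivative_eq_intros)
  moreover have "((\<lambda>y. Ln (1 - y)) has_field_derivative - (1 / (1 - y))) (at y)"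
    using assms by (auto intro!: derivative_eq_intros simp: divide_simps)
  ultimately show ?thesis
    unfolding LogP_def geometric using DERIV_add by fastforce
qed

definition LogP_sym :: "nat \<Rightarrow> real \<Rightarrow> complex \<Rightarrow> complex" where
  "LogP_sym r a x = of_real a ^ (r - 1) *
     (LogP r (x / of_real a) + (-1) ^ (r - 1) * LogP r (- (x / of_real a)))"

lemma LogP_sym_0: "LogP_sym r a 0 = 0"
  by (simp add: LogP_sym_def LogP_0)

lemma
  assumes "a > 0" "Im x = 0 \<longrightarrow> \<bar>Re x\<bar> < a"
  shows one_minus_divide_notin_nonpos_Reals: "1 - x / of_real a \<notin> \<real>\<^sub>\<le>\<^sub>0"
    and one_plus_divide_notin_nonpos_Reals: "1 + x / of_real a \<notin> \<real>\<^sub>\<le>\<^sub>0"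
  using assms by (auto simp: complex_nonpos_Reals_iff field_simps)

lemma cnj_LogP_sym:
  assumes "a > 0" "Im x = 0 \<longrightarrow> \<bar>Re x\<bar> < a"
  shows "cnj (LogP_sym r a x) = LogP_sym r a (cnj x)"
  using one_minus_divide_notin_nonpos_Reals[OF assms] one_plus_divide_notin_nonpos_Reals[OF assms]
  by (simp add: LogP_sym_def cnj_LogP)

definition LogP_sym_deriv :: "nat \<Rightarrow> real \<Rightarrow> complex \<Rightarrow> complex" where
  "LogP_sym_deriv r a x = - (2 * x ^ r / (of_real a ^ 2 - x ^ 2))"

lemma LogP_sym_has_field_derivative:
  assumes "a > 0" "Im x = 0 \<longrightarrow> \<bar>Re x\<bar> < a" "r > 0"
  shows "(LogP_sym r a has_field_derivative LogP_sym_deriv r a x) (at x)"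
proof -
  define A y where "A = complex_of_real a" and "y = x / A"
  have "A \<noteq> 0" and x_eq: "x = A * y"
    using assms(1) by (simp_all add: A_def y_def)
  have cut: "1 - y \<notin> \<real>\<^sub>\<le>\<^sub>0" "1 - - y \<notin> \<real>\<^sub>\<le>\<^sub>0"
    using one_minus_divide_notin_nonpos_Reals[OF assms(1,2)]
      one_plus_divide_notin_nonpos_Reals[OF assms(1,2)] by (simp_all add: y_def A_def)
  then have nonzero: "1 - y \<noteq> 0" "1 + y \<noteq> 0" by auto
  have "((\<lambda>x. LogP r (x / A)) has_field_derivative - (y ^ r / (1 - y)) * (1 / A)) (at x)"
    unfolding y_def by (rule DERIV_chain2[OF LogP_has_field_derivative])
      (use cut \<open>A \<noteq> 0\<close> in \<open>auto simp: y_def intro!: derivative_eq_intros\<close>)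
  moreover have "((\<lambda>x. LogP r (- (x / A))) has_field_derivative
      - ((- y) ^ r / (1 - - y)) * (- (1 / A))) (at x)"
    unfolding y_def by (rule DERIV_chain2[OF LogP_has_field_derivative])
      (use cut \<open>A \<noteq> 0\<close> in \<open>auto simp: y_def intro!: derivative_eq_intros\<close>)
  ultimately have "(LogP_sym r a has_field_derivative A ^ (r - 1) *
      (- (y ^ r / (1 - y)) * (1 / A) + (-1) ^ (r - 1) * (- ((- y) ^ r / (1 - - y)) * (- (1 / A))))) (at x)"
    unfolding LogP_sym_def A_def[symmetric] by (intro DERIV_cmult DERIV_add)
  also have "(-1) ^ (r - 1) * (- ((- y) ^ r / (1 - - y)) * (- (1 / A))) = - (y ^ r / (1 + y)) * (1 / A)"
    using assms(3) by (cases r) (auto simp: power_minus[of y] simp flip: power_add mult_2)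
  also have "A ^ (r - 1) * (- (y ^ r / (1 - y)) * (1 / A) + - (y ^ r / (1 + y)) * (1 / A)) =
      - (A ^ (r - 1) / A * (y ^ r / (1 - y) + y ^ r / (1 + y)))"
    by (simp add: algebra_simps)
  also have "y ^ r / (1 - y) + y ^ r / (1 + y) = 2 * y ^ r / ((1 - y) * (1 + y))"
    using nonzero by (simp add: divide_simps) (simp add: algebra_simps)
  also have "A ^ (r - 1) / A = A ^ r / A ^ 2"
    using \<open>A \<noteq> 0\<close> assms(3) by (cases r) (auto simp: power2_eq_square)
  also have "- (A ^ r / A ^ 2 * (2 * y ^ r / ((1 - y) * (1 + y)))) = LogP_sym_deriv r a x"
    unfolding LogP_sym_deriv_def x_eq A_def[symmetric] by (simp add: power_mult_distrib algebra_simps power2_eq_square)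
  finally show ?thesis .
qed

text \<open>The open lower half-plane together with the real interval \<open>(-c, c)\<close>: it is convex, so that
  series can be differentiated termwise on it, and it makes the real case a boundary case of the
  lower half-plane.\<close>
definition slit_half_plane :: "real \<Rightarrow> complex set" where
  "slit_half_plane c = {x. Im x < 0 \<or> Im x = 0 \<and> \<bar>Re x\<bar> < c}"

lemma slit_half_planeI: "Im x < 0 \<Longrightarrow> x \<in> slit_half_plane c"
  by (simp add: slit_half_plane_def)

lemma convex_slit_half_plane: "convex (slit_half_plane c)"
  unfolding convex_contains_open_segment
proof (intro ballI subsetI)
  fix x y z assume x: "x \<in> slit_half_plane c" and y: "y \<in> slit_half_plane c" and "z \<in> open_segment x y"
  then obtain u where u: "0 < u" "u < 1" and z: "z = (1 - u) *\<^sub>R x + u *\<^sub>R y"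
    by (auto simp: in_segment)
  have Im: "Im x \<le> 0" "Im y \<le> 0"
    using x y by (auto simp: slit_half_plane_def)
  show "z \<in> slit_half_plane c"
  proof (cases "Im x = 0 \<and> Im y = 0")
    case True
    then have "Re x \<in> {-c<..<c}" "Re y \<in> {-c<..<c}"
      using x y by (auto simp: slit_half_plane_def)
    from convexD[OF convex_real_interval(8) this, of "1 - u" u] show ?thesis
      using True u by (auto simp: z slit_half_plane_def)
  next
    case False
    have "(1 - u) * Im x \<le> 0" "u * Im y \<le> 0"
      using Im u by (simp_all add: mult_nonneg_nonpos)
    moreover have "(1 - u) * Im x \<noteq> 0 \<or> u * Im y \<noteq> 0"
      using False u by simp
    ultimately have "(1 - u) * Im x + u * Im y < 0"
      by linarith
    then show ?thesis
      by (simp add: z slit_half_plane_def)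
  qed
qed

lemma has_field_derivative_series_within:
  fixes f :: "nat \<Rightarrow> 'a::{real_normed_field,banach} \<Rightarrow> 'a"
  assumes "convex S"
    and deriv: "\<And>m x. x \<in> S \<Longrightarrow> (f m has_field_derivative f' m x) (at x within S)"
    and limit: "\<And>R. uniform_limit (S \<inter> ball 0 R) (\<lambda>N x. \<Sum>m<N. f' m x) (\<lambda>x. \<Sum>m. f' m x) sequentially"
    and "x0 \<in> S" "summable (\<lambda>m. f m x0)" "x \<in> S"
  shows "summable (\<lambda>m. f m x)"
    and "((\<lambda>x. \<Sum>m. f m x) has_field_derivative (\<Sum>m. f' m x)) (at x within S)"
proof -
  define B where "B = ball (0::'a) (max (norm x) (norm x0) + 1)"
  have "x \<in> S \<inter> B" "x0 \<in> S \<inter> B"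
    using assms by (auto simp: B_def)
  have "\<exists>g. \<forall>x\<in>S \<inter> B. (\<lambda>m. f m x) sums g x \<and> (g has_field_derivative (\<Sum>m. f' m x)) (at x within S \<inter> B)"
  proof (rule has_field_derivative_series)
    show "convex (S \<inter> B)"
      unfolding B_def by (intro convex_Int convex_ball assms)
    show "(f m has_field_derivative f' m x) (at x within S \<inter> B)" if "x \<in> S \<inter> B" for m x
      using that by (intro has_field_derivative_subset[OF deriv]) auto
  qed (use limit assms(5) \<open>x0 \<in> S \<inter> B\<close> in \<open>auto simp: B_def\<close>)
  then obtain g where g_sums: "\<And>x. x \<in> S \<inter> B \<Longrightarrow> (\<lambda>m. f m x) sums g x"
    and g_deriv: "(g has_field_derivative (\<Sum>m. f' m x)) (at x within S \<inter> B)"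
    using \<open>x \<in> S \<inter> B\<close> by blast
  show "summable (\<lambda>m. f m x)"
    using g_sums[OF \<open>x \<in> S \<inter> B\<close>] by (simp add: sums_iff)
  have "((\<lambda>x. \<Sum>m. f m x) has_field_derivative (\<Sum>m. f' m x)) (at x within S \<inter> B)"
    by (rule has_field_derivative_transform_within[OF g_deriv zero_less_one \<open>x \<in> S \<inter> B\<close>])
      (use g_sums in \<open>simp add: sums_iff\<close>)
  also have "at x within S \<inter> B = at x within S"
    by (rule at_within_nhd[of _ B]) (use \<open>x \<in> S \<inter> B\<close> in \<open>auto simp: B_def\<close>)
  finally show "((\<lambda>x. \<Sum>m. f m x) has_field_derivative (\<Sum>m. f' m x)) (at x within S)" .
qed

lemma uniform_limit_LogP_sym_deriv:
  fixes a :: "nat \<Rightarrow> real" and S :: "complex set"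
  assumes "\<And>m. a m > 0" "summable (\<lambda>m. 1 / a m ^ 2)" "S \<subseteq> ball 0 R"
  shows "uniform_limit S (\<lambda>N x. \<Sum>m<N. LogP_sym_deriv r (a m) x)
    (\<lambda>x. \<Sum>m. LogP_sym_deriv r (a m) x) sequentially"
proof (rule Weierstrass_m_test_ev)
  show "summable (\<lambda>m. 4 * R ^ r * (1 / a m ^ 2))"
    by (intro summable_mult assms)
  have "(\<lambda>m. 2 * R ^ 2 * (1 / a m ^ 2)) \<longlonglongrightarrow> 2 * R ^ 2 * 0"
    by (intro tendsto_intros summable_LIMSEQ_zero assms)
  then have "\<forall>\<^sub>F m in sequentially. 2 * R ^ 2 * (1 / a m ^ 2) < 1"
    by (rule order_tendstoD) simp
  then show "\<forall>\<^sub>F m in sequentially. \<forall>x\<in>S.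
      norm (LogP_sym_deriv r (a m) x) \<le> 4 * R ^ r * (1 / a m ^ 2)"
  proof (eventually_elim, intro ballI)
    fix m x assume "2 * R ^ 2 * (1 / a m ^ 2) < 1" "x \<in> S"
    then have R_le: "2 * R ^ 2 \<le> a m ^ 2" and x_le: "norm x \<le> R"
      using assms(1)[of m] assms(3) by (auto simp: field_simps)
    have "a m ^ 2 - norm x ^ 2 \<le> norm (of_real (a m) ^ 2 - x ^ 2)"
      using norm_triangle_ineq2[of "of_real (a m) ^ 2" "x ^ 2"] by (simp add: norm_power)
    moreover have "norm x ^ 2 \<le> R ^ 2"
      using x_le by (intro power_mono) auto
    ultimately have denominator: "a m ^ 2 / 2 \<le> norm (of_real (a m) ^ 2 - x ^ 2)"
      using R_le by linarith
    have "norm (LogP_sym_deriv r (a m) x) = 2 * norm x ^ r / norm (of_real (a m) ^ 2 - x ^ 2)"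
      by (simp add: LogP_sym_deriv_def norm_divide norm_mult norm_power)
    also have "\<dots> \<le> 2 * R ^ r / (a m ^ 2 / 2)"
      using x_le denominator assms(1)[of m] order_trans[OF norm_ge_zero x_le]
      by (intro frac_le mult_left_mono power_mono) auto
    finally show "norm (LogP_sym_deriv r (a m) x) \<le> 4 * R ^ r * (1 / a m ^ 2)"
      by simp
  qed
qed

lemma
  fixes a :: "nat \<Rightarrow> real"
  assumes "c > 0" "\<And>m. a m \<ge> c" "summable (\<lambda>m. 1 / a m ^ 2)" "x \<in> slit_half_plane c" "r > 0"
  shows summable_LogP_sym: "summable (\<lambda>m. LogP_sym r (a m) x)"
    and LogP_sym_series_has_field_derivative: "((\<lambda>x. \<Sum>m. LogP_sym r (a m) x) has_field_derivative
      (\<Sum>m. LogP_sym_deriv r (a m) x)) (at x within slit_half_plane c)"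
proof -
  have pos: "a m > 0" for m
    using assms(1,2) less_le_trans by blast
  have deriv: "(LogP_sym r (a m) has_field_derivative LogP_sym_deriv r (a m) y) (at y within slit_half_plane c)"
    if "y \<in> slit_half_plane c" for m y
  proof (rule has_field_derivative_at_within[OF LogP_sym_has_field_derivative])
    show "Im y = 0 \<longrightarrow> \<bar>Re y\<bar> < a m"
      using that assms(2)[of m] by (auto simp: slit_half_plane_def)
  qed (use pos assms(5) in auto)
  have limit: "uniform_limit (slit_half_plane c \<inter> ball 0 R) (\<lambda>N y. \<Sum>m<N. LogP_sym_deriv r (a m) y)
      (\<lambda>y. \<Sum>m. LogP_sym_deriv r (a m) y) sequentially" for R
    by (rule uniform_limit_LogP_sym_deriv[OF pos assms(3)]) auto
  have at_0: "0 \<in> slit_half_plane c" "summable (\<lambda>m. LogP_sym r (a m) 0)"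
    using assms(1) by (simp_all add: slit_half_plane_def LogP_sym_0)
  note series = has_field_derivative_series_within[OF convex_slit_half_plane deriv limit at_0 assms(4)]
  show "summable (\<lambda>m. LogP_sym r (a m) x)"
    by (rule series(1))
  show "((\<lambda>x. \<Sum>m. LogP_sym r (a m) x) has_field_derivative
      (\<Sum>m. LogP_sym_deriv r (a m) x)) (at x within slit_half_plane c)"
    by (rule series(2))
qed

definition log_multicos :: "nat \<Rightarrow> complex \<Rightarrow> complex" where
  "log_multicos r x = (\<Sum>m. LogP_sym r (real m + 1/2) x)"

lemma multicos_eq_exp: "multicos r x = exp (log_multicos r x)"
proof -
  have "complex_of_nat (2 * m + 1) = 2 * of_real (real m + 1/2)" for m
    by simp
  then show ?thesis
    unfolding multicos_def log_multicos_def LogP_sym_def by (simp only:) (simp del: of_real_add)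
qed

lemma log_multicos_0: "log_multicos r 0 = 0"
  by (simp add: log_multicos_def LogP_sym_0)

lemma summable_inverse_Suc_power: "k \<ge> 2 \<Longrightarrow> summable (\<lambda>n. inverse (real (Suc n) ^ k))"
  using inverse_power_summable[of k, where ?'a = real]
  by (subst summable_Suc_iff[of "\<lambda>n. inverse (real n ^ k)"]) simp

lemma summable_inverse_half_integer_squares: "summable (\<lambda>m. 1 / (real m + 1/2) ^ 2)"
proof (rule summable_comparison_test')
  show "summable (\<lambda>m. 4 * inverse (real (Suc m) ^ 2))"
    by (intro summable_mult summable_inverse_Suc_power) simp
  show "norm (1 / (real m + 1/2) ^ 2) \<le> 4 * inverse (real (Suc m) ^ 2)" for m
  proof -
    have "(real (Suc m)) ^ 2 \<le> (2 * (real m + 1/2)) ^ 2"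
      by (intro power_mono) auto
    then show ?thesis
      by (simp add: power_mult_distrib field_simps del: of_nat_Suc)
  qed
qed

lemma log_multicos_has_field_derivative:
  assumes "x \<in> slit_half_plane (1/2)" "r > 0"
  shows "(log_multicos r has_field_derivative - (of_real pi * x ^ (r - 1) * tan (of_real pi * x)))
    (at x within slit_half_plane (1/2))"
proof -
  have "x + 1/2 \<notin> \<int>"
  proof
    assume "x + 1/2 \<in> \<int>"
    then obtain n where "x + 1/2 = of_int n" by (elim Ints_cases)
    then have "x = of_real (of_int n - 1/2)" by (simp add: algebra_simps)
    with assms(1) have "\<bar>real_of_int n - 1/2\<bar> < 1/2"
      by (simp add: slit_half_plane_def)
    then have "0 < real_of_int n" "real_of_int n < 1"
      by linarith+
    then show False by simp
  qed
  then have "(\<lambda>m. - (x ^ (r - 1)) * (2 * x / (of_real (real m + 1/2) ^ 2 - x ^ 2))) sums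
      (- (x ^ (r - 1)) * (of_real pi * tan (of_real pi * x)))"
    by (intro sums_mult tan_partial_fractions)
  also have "(\<lambda>m. - (x ^ (r - 1)) * (2 * x / (of_real (real m + 1/2) ^ 2 - x ^ 2))) =
      (\<lambda>m. LogP_sym_deriv r (real m + 1/2) x)"
    unfolding LogP_sym_deriv_def using assms(2) by (cases r) auto
  finally have "(\<Sum>m. LogP_sym_deriv r (real m + 1/2) x) =
      - (of_real pi * x ^ (r - 1) * tan (of_real pi * x))"
    by (simp add: sums_iff mult_ac)
  moreover have "(log_multicos r has_field_derivative
      (\<Sum>m. LogP_sym_deriv r (real m + 1/2) x)) (at x within slit_half_plane (1/2))"
    unfolding log_multicos_def[abs_def]
    by (rule LogP_sym_series_has_field_derivative)
      (use assms summable_inverse_half_integer_squares in auto)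
  ultimately show ?thesis by simp
qed

lemma cnj_log_multicos:
  assumes "x \<in> slit_half_plane (1/2)" "r > 0"
  shows "cnj (log_multicos r x) = log_multicos r (cnj x)"
proof -
  have "(\<lambda>m. LogP_sym r (real m + 1/2) x) sums log_multicos r x"
    unfolding log_multicos_def
    by (intro summable_sums summable_LogP_sym[of "1/2"] summable_inverse_half_integer_squares assms) auto
  then have "(\<lambda>m. cnj (LogP_sym r (real m + 1/2) x)) sums cnj (log_multicos r x)"
    by (simp only: sums_cnj)
  also have "(\<lambda>m. cnj (LogP_sym r (real m + 1/2) x)) = (\<lambda>m. LogP_sym r (real m + 1/2) (cnj x))"
    by (intro ext cnj_LogP_sym) (use assms(1) in \<open>auto simp: slit_half_plane_def\<close>)
  finally show ?thesis
    by (simp add: log_multicos_def sums_iff)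
qed

subsection \<open>Polylogarithms on the closed unit disc\<close>

lemma norm_polylog_term_le:
  assumes "norm (z::complex) \<le> 1"
  shows "norm (z ^ (n+1) / of_nat (n+1) ^ k) \<le> inverse (real (Suc n) ^ k)"
proof -
  have "norm (z ^ (n+1) / of_nat (n+1) ^ k) = norm z ^ (n+1) / real (n+1) ^ k"
    by (simp add: norm_divide norm_power norm_mult del: of_nat_Suc of_nat_add)
  also have "\<dots> \<le> 1 / real (n+1) ^ k"
    using assms by (intro divide_right_mono power_le_one) auto
  finally show ?thesis by (simp add: divide_inverse)
qed

lemma summable_polylog_cball:
  assumes "k \<ge> 2" "norm (z::complex) \<le> 1"
  shows "summable (\<lambda>n. z ^ (n+1) / of_nat (n+1) ^ k)"
  by (rule summable_comparison_test'[OF summable_inverse_Suc_power[OF assms(1)]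
    norm_polylog_term_le[OF assms(2)]])

lemma summable_polylog:
  assumes "norm (z::complex) < 1"
  shows "summable (\<lambda>n. z ^ (n+1) / of_nat (n+1) ^ k)"
proof (rule summable_comparison_test')
  show "summable (\<lambda>n. norm z ^ (n+1))"
    using assms summable_mult[OF summable_geometric, of "norm z" "norm z"] by simp
  show "norm (z ^ (n+1) / of_nat (n+1) ^ k) \<le> norm z ^ (n+1)" for n
    using divide_left_mono[OF one_le_power[of "real (n+1)" k], of "norm z ^ (n+1)"]
    by (simp add: norm_divide norm_power norm_mult del: of_nat_Suc of_nat_add)
qed

lemma polylog_0: "norm z < 1 \<Longrightarrow> polylog 0 z = z / (1 - z)"
  using sums_mult[OF geometric_sums[of z], of z] by (simp add: polylog_def sums_iff)

lemma polylog_1: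
  assumes "norm z < 1"
  shows "polylog 1 z = - Ln (1 - z)"
proof -
  have "(\<lambda>n. z ^ n / of_nat n) sums - Ln (1 - z)"
    using sums_minus[OF Ln_series'[of "-z"]] assms by simp
  then have "(\<lambda>n. z ^ Suc n / of_nat (Suc n)) sums - Ln (1 - z)"
    by (subst sums_Suc_iff) simp
  then show ?thesis
    by (simp add: polylog_def sums_iff)
qed

lemma polylog_minus_1:
  assumes "k \<ge> 2"
  shows "polylog k (-1) = - of_real (zetaE k)"
proof -
  have "summable (\<lambda>n. (-1) ^ n / real (n+1) ^ k)"
    by (rule summable_comparison_test'[OF summable_inverse_Suc_power[OF assms]])
      (simp add: abs_mult power_abs divide_inverse)
  then have sums: "(\<lambda>n. - ((-1) ^ n / real (n+1) ^ k)) sums - zetaE k"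
    unfolding zetaE_def by (intro sums_minus summable_sums)
  have "polylog k (-1) = (\<Sum>n. of_real (- ((-1) ^ n / real (n+1) ^ k)))"
    by (simp add: polylog_def)
  also have "\<dots> = of_real (- zetaE k)"
    by (rule sums_unique[OF sums_of_real[OF sums], symmetric])
  finally show ?thesis by simp
qed

lemma cnj_polylog:
  assumes "norm z < 1"
  shows "cnj (polylog k z) = polylog k (cnj z)"
proof -
  have "(\<lambda>n. cnj (z ^ (n+1) / of_nat (n+1) ^ k)) sums cnj (polylog k z)"
    using summable_sums[OF summable_polylog[OF assms, of k]] by (simp only: sums_cnj polylog_def)
  then show ?thesis
    by (simp add: polylog_def sums_iff)
qed

lemma polylog_Suc_has_field_derivative:
  assumes "norm z < 1" "z \<noteq> 0"
  shows "(polylog (Suc k) has_field_derivative polylog k z / z) (at z)"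
proof -
  define c where "c n = (if n = 0 then 0 else 1 / of_nat n ^ Suc k :: complex)" for n
  have power_series: "(\<lambda>n. c n * w ^ n) sums polylog (Suc k) w" if "norm w < 1" for w
  proof -
    have "(\<lambda>n. c (Suc n) * w ^ Suc n) sums polylog (Suc k) w"
      using summable_sums[OF summable_polylog[OF that, of "Suc k"]]
      by (simp add: c_def polylog_def)
    from sums_Suc[OF this] show ?thesis by (simp add: c_def)
  qed
  have "((\<lambda>z. \<Sum>n. c n * z ^ n) has_field_derivative (\<Sum>n. diffs c n * z ^ n)) (at z)"
    by (rule termdiffs_strong'[of 1]) (use power_series assms in \<open>auto simp: sums_iff\<close>)
  moreover have "(\<Sum>n. diffs c n * z ^ n) = polylog k z / z"
  proof -
    have "diffs c n * z ^ n = z ^ (n + 1) / of_nat (n + 1) ^ k / z" for n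
      using assms(2) by (simp add: diffs_def c_def field_simps del: of_nat_Suc)
    then show ?thesis
      using suminf_divide[OF summable_polylog[OF assms(1), of k], of z] by (simp add: polylog_def)
  qed
  ultimately show ?thesis
    using has_field_derivative_transform_within_open
        [of "\<lambda>z. \<Sum>n. c n * z ^ n" _ z "ball 0 1" "polylog (Suc k)"]
      assms(1) power_series[THEN sums_unique] by auto
qed

lemma continuous_on_polylog:
  assumes "k \<ge> 2"
  shows "continuous_on (cball 0 1) (polylog k)"
proof -
  have "uniform_limit (cball 0 1) (\<lambda>N z. \<Sum>n<N. z ^ (n+1) / of_nat (n+1) ^ k)
      (\<lambda>z::complex. \<Sum>n. z ^ (n+1) / of_nat (n+1) ^ k) sequentially"
    by (rule Weierstrass_m_test[OF norm_polylog_term_le summable_inverse_Suc_power[OF assms]]) simp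
  then show ?thesis
    unfolding polylog_def
    by (rule uniform_limit_theorem[rotated])
      (auto intro!: always_eventually continuous_intros simp del: of_nat_Suc of_nat_add)
qed

text \<open>\<open>Li\<^sub>1\<close> is replaced by its closed form so that the function stays continuous on the unit circle
  away from 1, without having to discuss conditional convergence there.\<close>
definition polylog_ext :: "nat \<Rightarrow> complex \<Rightarrow> complex" where
  "polylog_ext k z = (if k = 1 then - Ln (1 - z) else polylog k z)"

lemma polylog_ext_eq: "norm z < 1 \<Longrightarrow> polylog_ext k z = polylog k z"
  using polylog_1[of z] by (simp add: polylog_ext_def)

lemma polylog_ext_Suc_has_field_derivative:
  assumes "norm z < 1" "z \<noteq> 0"
  shows "(polylog_ext (Suc k) has_field_derivative polylog_ext k z / z) (at z)"
proof -
  have "(polylog (Suc k) has_field_derivative polylog_ext k z / z) (at z)"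
    using polylog_Suc_has_field_derivative[OF assms] polylog_ext_eq[OF assms(1)] by simp
  then show ?thesis
    by (rule has_field_derivative_transform_within_open[of _ _ _ "ball 0 1"])
      (use assms(1) polylog_ext_eq in auto)
qed

lemma continuous_on_polylog_ext:
  assumes "k > 0"
  shows "continuous_on {z. norm z \<le> 1 \<and> 1 - z \<notin> \<real>\<^sub>\<le>\<^sub>0} (polylog_ext k)"
proof (cases "k = 1")
  case True
  then show ?thesis
    unfolding polylog_ext_def[abs_def] by (auto intro!: continuous_intros)
next
  case False
  with assms have "continuous_on (cball 0 1) (polylog k)"
    by (intro continuous_on_polylog) auto
  then have "continuous_on {z. norm z \<le> 1 \<and> 1 - z \<notin> \<real>\<^sub>\<le>\<^sub>0} (polylog k)"
    by (rule continuous_on_subset) auto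
  with False show ?thesis
    by (simp add: polylog_ext_def[abs_def])
qed

subsection \<open>The closed form in the half-planes\<close>

definition polylog_ext_sum :: "complex \<Rightarrow> nat \<Rightarrow> complex \<Rightarrow> complex" where
  "polylog_ext_sum w r x = (\<Sum>k<r. w ^ k / fact k * polylog_ext (r - k) (- exp (- w * x)) * x ^ k)"

definition multicos_exponent :: "complex \<Rightarrow> nat \<Rightarrow> complex \<Rightarrow> complex" where
  "multicos_exponent w r x =
     - (fact (r - 1) / (2 * w) ^ (r - 1)) * polylog_ext_sum w r x
     + w / of_nat r * (x / 2) ^ r
     - fact (r - 1) / (2 * w) ^ (r - 1) * of_real (zetaE r)"

lemma multicos_exponent_0:
  assumes "r \<ge> 2"
  shows "multicos_exponent w r 0 = 0"
proof -
  obtain s where "r = Suc s"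
    using assms by (cases r) auto
  then have "polylog_ext_sum w r 0 = polylog_ext r (- 1)"
    by (simp only: polylog_ext_sum_def sum.lessThan_Suc_shift) simp
  then show ?thesis
    using assms polylog_minus_1[OF assms] by (simp add: multicos_exponent_def polylog_ext_def)
qed

lemma multicos_exponent_eq_polylog:
  assumes "norm (exp (- w * x)) < 1" "r > 0"
  shows "multicos_exponent w r x =
     - (of_nat (fact (r - 1)) / (2 * w) ^ (r - 1)) *
         (\<Sum>k=0..r-1. w ^ k / of_nat (fact k) * polylog (r - k) (- exp (- w * x)) * x ^ k)
     + w / of_nat r * (x / 2) ^ r
     - of_nat (fact (r - 1)) / (2 * w) ^ (r - 1) * of_real (zetaE r)"
proof -
  have "{0..r-1} = {..<r}"
    using assms(2) by auto
  then show ?thesis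
    using assms(1) by (simp add: multicos_exponent_def polylog_ext_sum_def polylog_ext_eq)
qed

lemma cnj_multicos_exponent:
  assumes "norm (exp (- w * x)) < 1"
  shows "cnj (multicos_exponent w r x) = multicos_exponent (cnj w) r (cnj x)"
proof -
  have "norm (exp (- cnj w * cnj x)) < 1"
    using assms complex_mod_cnj[of "exp (- w * x)"] by (simp add: exp_cnj)
  then show ?thesis
    using assms by (simp add: multicos_exponent_def polylog_ext_sum_def polylog_ext_eq cnj_polylog exp_cnj)
qed

lemma polylog_ext_exp_has_field_derivative:
  assumes "norm (exp (- w * x)) < 1"
  shows "((\<lambda>x. polylog_ext (Suc k) (- exp (- w * x))) has_field_derivative
    - w * polylog_ext k (- exp (- w * x))) (at x)"
proof -
  have "((\<lambda>x. - exp (- w * x)) has_field_derivative w * exp (- w * x)) (at x)"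
    by (auto intro!: derivative_eq_intros)
  from DERIV_chain2[OF polylog_ext_Suc_has_field_derivative this] assms
  have "((\<lambda>x. polylog_ext (Suc k) (- exp (- w * x))) has_field_derivative
      polylog_ext k (- exp (- w * x)) / - exp (- w * x) * (w * exp (- w * x))) (at x)"
    by simp
  then show ?thesis by (simp add: mult.commute)
qed

lemma polylog_ext_sum_has_field_derivative:
  assumes "norm (exp (- w * x)) < 1" "r > 0"
  shows "(polylog_ext_sum w r has_field_derivative
    - (w ^ r / fact (r - 1) * polylog_ext 0 (- exp (- w * x)) * x ^ (r - 1))) (at x)"
proof -
  define L where "L k = polylog_ext k (- exp (- w * x))" for k
  define telescope where "telescope k = of_nat k * w ^ k / fact k * L (r - k) * x ^ (k - 1)" for k
  have telescope_Suc: "telescope (Suc k) = w ^ Suc k / fact k * L (r - Suc k) * x ^ k" for k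
    by (simp add: telescope_def fact_Suc del: of_nat_Suc power_Suc)
  have "((\<lambda>x. w ^ k / fact k * polylog_ext (r - k) (- exp (- w * x)) * x ^ k)
      has_field_derivative (telescope k - telescope (Suc k))) (at x)" if "k < r" for k
  proof -
    have r_minus_k: "r - k = Suc (r - Suc k)"
      using that by simp
    have "((\<lambda>x. w ^ k / fact k * polylog_ext (r - k) (- exp (- w * x)) * x ^ k) has_field_derivative
        (w ^ k / fact k * (- w * L (r - Suc k))) * x ^ k +
        (of_nat k * x ^ (k - 1)) * (w ^ k / fact k * L (r - k))) (at x)"
      unfolding L_def r_minus_k
      by (intro DERIV_mult DERIV_cmult polylog_ext_exp_has_field_derivative assms)
        (auto intro!: derivative_eq_intros)
    then show ?thesis
      unfolding telescope_Suc by (simp add: telescope_def algebra_simps)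
  qed
  then have "(polylog_ext_sum w r has_field_derivative (\<Sum>k<r. telescope k - telescope (Suc k))) (at x)"
    unfolding polylog_ext_sum_def[abs_def] by (intro DERIV_sum) auto
  also have "(\<Sum>k<r. telescope k - telescope (Suc k)) = telescope 0 - telescope r"
    by (rule sum_lessThan_telescope')
  also have "\<dots> = - telescope (Suc (r - 1))"
    using assms(2) by (simp add: telescope_def)
  finally show ?thesis
    unfolding telescope_Suc using assms(2) by (simp add: L_def)
qed

lemma multicos_exponent_has_field_derivative:
  assumes "norm (exp (- w * x)) < 1" "r > 0" "w \<noteq> 0"
  shows "(multicos_exponent w r has_field_derivative
    w * (x / 2) ^ (r - 1) * (1/2 + polylog_ext 0 (- exp (- w * x)))) (at x)"
proof -
  define L where "L = polylog_ext 0 (- exp (- w * x))"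
  define c where "c = fact (r - 1) / (2 * w) ^ (r - 1)"
  have "((\<lambda>x. w / of_nat r * (x / 2) ^ r) has_field_derivative w / 2 * (x / 2) ^ (r - 1)) (at x)"
    using assms(2) by (auto intro!: derivative_eq_intros)
  then have "(multicos_exponent w r has_field_derivative
      - c * - (w ^ r / fact (r - 1) * L * x ^ (r - 1)) + w / 2 * (x / 2) ^ (r - 1) - 0) (at x)"
    unfolding multicos_exponent_def[abs_def] c_def L_def
    by (intro DERIV_diff DERIV_add DERIV_cmult DERIV_const polylog_ext_sum_has_field_derivative assms)
  also have "- c * - (w ^ r / fact (r - 1) * L * x ^ (r - 1)) = w * (x / 2) ^ (r - 1) * L"
    using assms(2,3) by (cases r) (simp_all add: c_def power_mult_distrib power_divide)
  finally show ?thesis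
    by (simp add: L_def algebra_simps)
qed

lemma i_times_tan_eq_exp:
  fixes y :: complex
  assumes "1 + exp (- 2 * \<i> * y) \<noteq> 0"
  shows "\<i> * tan y = (1 - exp (- 2 * \<i> * y)) / (1 + exp (- 2 * \<i> * y))"
proof -
  define u where "u = exp (\<i> * y)"
  have "u \<noteq> 0" by (simp add: u_def)
  have exp: "exp (- 2 * \<i> * y) = 1 / u ^ 2"
    unfolding u_def by (simp add: exp_minus exp_double field_simps flip: exp_of_nat_mult)
  have "u ^ 2 + 1 \<noteq> 0"
    using assms \<open>u \<noteq> 0\<close> unfolding exp by (simp add: field_simps)
  then have "\<i> * tan y = (u ^ 2 - 1) / (u ^ 2 + 1)"
    unfolding tan_def sin_exp_eq cos_exp_eq exp_minus mult_minus_left u_def[symmetric]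
    using \<open>u \<noteq> 0\<close> by (simp add: divide_simps power2_eq_square)
  with \<open>u ^ 2 + 1 \<noteq> 0\<close> show ?thesis
    unfolding exp using \<open>u \<noteq> 0\<close> by (simp add: divide_simps)
qed

lemma half_plus_polylog_0_exp:
  assumes "norm (exp (- (2 * \<i> * y))) < 1"
  shows "1/2 + polylog_ext 0 (- exp (- (2 * \<i> * y))) = \<i> / 2 * tan y"
proof -
  define q where "q = exp (- (2 * \<i> * y))"
  have "1 + q \<noteq> 0"
    using assms by (metis add_eq_0_iff norm_minus_cancel norm_one less_irrefl q_def)
  then have "\<i> * tan y = (1 - q) / (1 + q)"
    using i_times_tan_eq_exp[of y] by (simp add: q_def)
  moreover have "polylog_ext 0 (- q) = - q / (1 + q)"
    using assms by (simp add: polylog_ext_eq polylog_0 q_def)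
  moreover have "1/2 + - q / (1 + q) = (1 - q) / (1 + q) / 2"
    using \<open>1 + q \<noteq> 0\<close> by (simp add: field_simps)
  ultimately show ?thesis
    by (simp add: q_def)
qed

lemma one_plus_exp_notin_nonpos_Reals:
  assumes "x \<in> slit_half_plane 1"
  shows "1 + exp (- (of_real pi * \<i>) * x) \<notin> \<real>\<^sub>\<le>\<^sub>0"
proof -
  have "-1 < Re (exp (- (of_real pi * \<i>) * x))"
  proof (cases "Im x = 0")
    case True
    then have "\<bar>Re x\<bar> < 1"
      using assms by (auto simp: slit_half_plane_def)
    then have "cos pi < cos (pi * \<bar>Re x\<bar>)"
      by (intro cos_monotone_0_pi) auto
    with True show ?thesis
      by (simp add: Re_exp abs_if split: if_splits)
  next
    case False
    then have "norm (exp (- (of_real pi * \<i>) * x)) < 1"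
      using assms by (simp add: slit_half_plane_def mult_pos_neg)
    then show ?thesis
      using abs_Re_le_cmod[of "exp (- (of_real pi * \<i>) * x)"] by linarith
  qed
  then show ?thesis
    by (simp add: complex_nonpos_Reals_iff)
qed

lemma continuous_on_multicos_exponent:
  "continuous_on (slit_half_plane 1) (multicos_exponent (of_real pi * \<i>) r)"
proof -
  have "- exp (- (of_real pi * \<i>) * x) \<in> {z. norm z \<le> 1 \<and> 1 - z \<notin> \<real>\<^sub>\<le>\<^sub>0}"
    if "x \<in> slit_half_plane 1" for x
    using that one_plus_exp_notin_nonpos_Reals[OF that]
    by (auto simp: slit_half_plane_def mult_le_0_iff)
  then have "continuous_on (slit_half_plane 1) (\<lambda>x. polylog_ext k (- exp (- (of_real pi * \<i>) * x)))"
    if "k > 0" for k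
    using that
    by (intro continuous_on_compose2[OF continuous_on_polylog_ext[of k]] continuous_intros) auto
  then show ?thesis
    unfolding multicos_exponent_def[abs_def] polylog_ext_sum_def by (intro continuous_intros) auto
qed

lemma has_field_derivative_zero_constant_dense:
  fixes f :: "'a::real_normed_field \<Rightarrow> 'a"
  assumes "continuous_on S f" "convex U" "U \<subseteq> S" "S \<subseteq> closure U"
    and deriv: "\<And>z. z \<in> U \<Longrightarrow> (f has_field_derivative 0) (at z)"
    and "x \<in> S" "y \<in> S"
  shows "f x = f y"
proof -
  have "\<exists>C. \<forall>z\<in>U. f z = C"
    by (rule has_field_derivative_zero_constant[OF \<open>convex U\<close> has_field_derivative_at_within[OF deriv]])
  then obtain C where f_eq: "\<And>z. z \<in> U \<Longrightarrow> f z = C"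
    by blast
  have "f z = C" if "z \<in> S" for z
  proof -
    have "z \<in> closure U"
      using that \<open>S \<subseteq> closure U\<close> by auto
    then obtain X where tendsto: "\<And>n. X n \<in> U" "X \<longlonglongrightarrow> z"
      unfolding closure_sequential by auto
    then have "(\<lambda>n. f (X n)) \<longlonglongrightarrow> f z"
      using assms(1,3) that by (intro continuous_on_tendsto_compose[of S f] always_eventually) auto
    with tendsto show ?thesis
      by (simp add: f_eq LIMSEQ_const_iff)
  qed
  then show ?thesis
    using assms by simp
qed

lemma slit_half_plane_subset_closure: "slit_half_plane c \<subseteq> closure {x. Im x < 0}"
proof -
  have "closure {x. \<i> \<bullet> x < 0} = {x. \<i> \<bullet> x \<le> 0}"
    by (rule closure_halfspace_lt) simp
  then have closure: "closure {x. Im x < 0} = {x. Im x \<le> 0}"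
    by (simp add: inner_complex_def)
  show ?thesis
    unfolding closure slit_half_plane_def by auto
qed

lemma continuous_on_log_multicos_half:
  assumes "r > 0"
  shows "continuous_on (slit_half_plane 1) (\<lambda>x. log_multicos r (x / 2))"
proof -
  have "continuous_on (slit_half_plane (1/2)) (log_multicos r)"
    by (rule DERIV_continuous_on[OF log_multicos_has_field_derivative]) (use assms in auto)
  then show ?thesis
    by (rule continuous_on_compose2) (auto simp: slit_half_plane_def intro!: continuous_intros)
qed

lemma log_multicos_half_has_field_derivative:
  assumes "Im y < 0" "r > 0"
  shows "((\<lambda>x. log_multicos r (x / 2)) has_field_derivative
    - (of_real pi / 2 * (y / 2) ^ (r - 1) * tan (of_real pi * (y / 2)))) (at y)"
proof -
  have "y / 2 \<in> interior (slit_half_plane (1/2))"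
    by (rule interiorI[OF open_halfspace_Im_lt[of 0]]) (use assms(1) in \<open>auto simp: slit_half_plane_def\<close>)
  then have "at (y / 2) within slit_half_plane (1/2) = at (y / 2)"
    by (rule at_within_interior)
  moreover have "y / 2 \<in> slit_half_plane (1/2)"
    using assms(1) by (simp add: slit_half_planeI)
  ultimately have "(log_multicos r has_field_derivative
      - (of_real pi * (y / 2) ^ (r - 1) * tan (of_real pi * (y / 2)))) (at (y / 2))"
    using log_multicos_has_field_derivative[of "y / 2" r] assms(2) by simp
  moreover have "((\<lambda>x. x / 2) has_field_derivative 1/2) (at y)"
    by (auto intro!: derivative_eq_intros)
  ultimately show ?thesis
    by (rule DERIV_cong[OF DERIV_chain2]) simp
qed

lemma multicos_exponent_lower_has_field_derivative:
  assumes "Im y < 0" "r > 0"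
  shows "(multicos_exponent (of_real pi * \<i>) r has_field_derivative
    - (of_real pi / 2 * (y / 2) ^ (r - 1) * tan (of_real pi * (y / 2)))) (at y)"
proof -
  define w where "w = of_real pi * \<i>"
  have w_times_y: "- w * y = - (2 * \<i> * (of_real pi * (y / 2)))"
    by (simp add: w_def)
  have less_1: "norm (exp (- w * y)) < 1"
    using assms(1) by (simp add: w_def mult_pos_neg)
  then have "1/2 + polylog_ext 0 (- exp (- w * y)) = \<i> / 2 * tan (of_real pi * (y / 2))"
    unfolding w_times_y by (rule half_plus_polylog_0_exp)
  moreover have "(multicos_exponent w r has_field_derivative
      w * (y / 2) ^ (r - 1) * (1/2 + polylog_ext 0 (- exp (- w * y)))) (at y)"
    by (rule multicos_exponent_has_field_derivative) (use less_1 assms(2) in \<open>auto simp: w_def\<close>)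
  ultimately show ?thesis
    unfolding w_def by (simp only:) (simp add: mult_ac)
qed

lemma log_multicos_eq_exponent:
  assumes "r \<ge> 2" "x \<in> slit_half_plane 1"
  shows "log_multicos r (x / 2) = multicos_exponent (of_real pi * \<i>) r x"
proof -
  define h where "h x = log_multicos r (x / 2) - multicos_exponent (of_real pi * \<i>) r x" for x
  have "continuous_on (slit_half_plane 1) h"
    unfolding h_def[abs_def] using assms(1)
    by (intro continuous_on_diff continuous_on_log_multicos_half continuous_on_multicos_exponent) auto
  moreover have "(h has_field_derivative 0) (at y)" if "y \<in> {x. Im x < 0}" for y
    unfolding h_def[abs_def]
    using that assms(1) DERIV_diff[OF log_multicos_half_has_field_derivative[of y r]
      multicos_exponent_lower_has_field_derivative[of y r]] by simp
  moreover have "{x. Im x < 0} \<subseteq> slit_half_plane 1" "0 \<in> slit_half_plane 1"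
    by (auto simp: slit_half_plane_def)
  ultimately have "h x = h 0"
    using has_field_derivative_zero_constant_dense[of "slit_half_plane 1" h "{x. Im x < 0}" x 0]
      convex_halfspace_Im_lt slit_half_plane_subset_closure assms(2) by blast
  also have "h 0 = 0"
    using assms(1) by (simp add: h_def log_multicos_0 multicos_exponent_0)
  finally show ?thesis
    by (simp add: h_def)
qed

lemma multicos_lower_half_plane:
  assumes "r \<ge> 2" "Im x < 0"
  shows "multicos r (x / 2) = exp (multicos_exponent (of_real pi * \<i>) r x)"
  using log_multicos_eq_exponent[OF assms(1) slit_half_planeI[OF assms(2)]] by (simp add: multicos_eq_exp)

lemma multicos_upper_half_plane:
  assumes "r \<ge> 2" "Im x > 0"
  shows "multicos r (x / 2) = exp (multicos_exponent (- (of_real pi * \<i>)) r x)"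
proof -
  have "log_multicos r (x / 2) = cnj (log_multicos r (cnj x / 2))"
    using cnj_log_multicos[of "cnj x / 2" r] assms by (simp add: slit_half_plane_def)
  also have "\<dots> = cnj (multicos_exponent (of_real pi * \<i>) r (cnj x))"
    using log_multicos_eq_exponent[OF assms(1) slit_half_planeI, of "cnj x"] assms(2) by simp
  also have "\<dots> = multicos_exponent (- (of_real pi * \<i>)) r x"
    using cnj_multicos_exponent[of "of_real pi * \<i>" "cnj x" r] assms(2) by (simp add: mult_pos_neg)
  finally show ?thesis
    by (simp add: multicos_eq_exp)
qed

subsection \<open>The closed form on the real interval\<close>

definition alternating_cos_series :: "nat \<Rightarrow> real \<Rightarrow> real" where
  "alternating_cos_series k x = (\<Sum>n. (-1) ^ (n+1) * cos (pi * real (n+1) * x) / real (n+1) ^ k)"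

definition alternating_sin_series :: "nat \<Rightarrow> real \<Rightarrow> real" where
  "alternating_sin_series k x = (\<Sum>n. (-1) ^ (n+1) * sin (pi * real (n+1) * x) / real (n+1) ^ k)"

lemma polylog_minus_cis:
  assumes "k \<ge> 2"
  shows "polylog k (- cis (- (pi * x))) =
    Complex (alternating_cos_series k x) (- alternating_sin_series k x)"
proof -
  define q where "q = - cis (- (pi * x))"
  have "(\<lambda>n. q ^ (n+1) / of_nat (n+1) ^ k) sums polylog k q"
    unfolding polylog_def by (intro summable_sums summable_polylog_cball assms) (simp add: q_def)
  moreover have "q ^ (n+1) / of_nat (n+1) ^ k = Complex ((-1) ^ (n+1) * cos (pi * real (n+1) * x) / real (n+1) ^ k)
      (- ((-1) ^ (n+1) * sin (pi * real (n+1) * x) / real (n+1) ^ k))" for n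
  proof -
    have "q ^ (n+1) = of_real ((-1) ^ (n+1)) * cis (- (pi * real (n+1) * x))"
      unfolding q_def power_minus[of "cis _"] Complex.DeMoivre by (simp add: mult_ac)
    then have "q ^ (n+1) / of_nat (n+1) ^ k =
        of_real ((-1) ^ (n+1) / real (n+1) ^ k) * cis (- (pi * real (n+1) * x))"
      by (simp del: of_nat_Suc of_nat_add power_Suc)
    then show ?thesis
      by (simp only: complex_eq_iff) simp
  qed
  ultimately have "(\<lambda>n. (-1) ^ (n+1) * cos (pi * real (n+1) * x) / real (n+1) ^ k) sums Re (polylog k q)"
    "(\<lambda>n. - ((-1) ^ (n+1) * sin (pi * real (n+1) * x) / real (n+1) ^ k)) sums Im (polylog k q)"
    by (simp_all only: sums_complex_iff complex.sel)
  from this(1) sums_minus[OF this(2)] show ?thesis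
    unfolding alternating_cos_series_def alternating_sin_series_def q_def[symmetric]
    by (simp only: sums_iff complex_eq_iff complex.sel minus_minus)
qed

lemma cos_pi_times_half_pos:
  assumes "\<bar>x\<bar> < 1"
  shows "cos (pi * x / 2) > 0"
proof -
  have "\<bar>pi * x / 2\<bar> < pi / 2"
    using assms by (simp add: abs_mult)
  then show ?thesis
    by (intro cos_gt_zero_pi) linarith+
qed

lemma one_plus_cis: "1 + cis (2 * t) = of_real (2 * cos t) * cis t"
  by (simp add: complex_eq_iff cos_double_cos sin_double power2_eq_square)

lemma Re_Ln_one_plus_cis:
  assumes "\<bar>x\<bar> < 1"
  shows "Re (Ln (1 + cis (- (pi * x)))) = ln (2 * cos (pi * x / 2))"
proof -
  have "norm (1 + cis (- (pi * x))) = 2 * cos (pi * x / 2)"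
    using one_plus_cis[of "- (pi * x / 2)"] cos_pi_times_half_pos[OF assms] by (simp add: norm_mult)
  moreover from this have "1 + cis (- (pi * x)) \<noteq> 0"
    using cos_pi_times_half_pos[OF assms] by auto
  ultimately show ?thesis
    using Re_Ln by metis
qed

lemma Re_divide_i_power: "Re (z / \<i> ^ n) = (-1) ^ (n div 2) * (if even n then Re z else Im z)"
proof -
  have "\<i> ^ n = (-1) ^ (n div 2) * (if even n then 1 else \<i>)"
    by (auto elim!: oddE)
  then show ?thesis
    by (simp only:) (cases "even (n div 2)"; simp)
qed

lemma multicos_exponent_of_real:
  fixes x :: real
  assumes "r > 0"
  defines "c \<equiv> fact (r - 1) / (2 * pi) ^ (r - 1)"
  shows "multicos_exponent (of_real pi * \<i>) r (of_real x) =
    - (\<Sum>k<r. of_real (c * (pi * x) ^ k / fact k) *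
        (polylog_ext (r - k) (- cis (- (pi * x))) / \<i> ^ (r - 1 - k)))
    + of_real (pi / of_nat r * (x / 2) ^ r) * \<i>
    - of_real (c * zetaE r) * (1 / \<i> ^ (r - 1))"
proof -
  have coefficient: "fact (r - 1) / (2 * (of_real pi * \<i>)) ^ (r - 1) = of_real c / \<i> ^ (r - 1)"
    by (simp add: c_def power_mult_distrib)
  have "of_real c / \<i> ^ (r - 1) * ((of_real pi * \<i>) ^ k / fact k * p * of_real x ^ k) =
      of_real (c * (pi * x) ^ k / fact k) * (p / \<i> ^ (r - 1 - k))" if "k < r" for k p
  proof -
    have "\<i> ^ (r - 1) = \<i> ^ k * \<i> ^ (r - 1 - k)"
      using that by (simp flip: power_add)
    then show ?thesis
      by (simp add: power_mult_distrib field_simps)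
  qed
  moreover have "exp (- (of_real pi * \<i>) * of_real x) = cis (- (pi * x))"
    by (simp add: cis_conv_exp mult_ac)
  ultimately have sum: "of_real c / \<i> ^ (r - 1) * polylog_ext_sum (of_real pi * \<i>) r (of_real x) =
      (\<Sum>k<r. of_real (c * (pi * x) ^ k / fact k) *
        (polylog_ext (r - k) (- cis (- (pi * x))) / \<i> ^ (r - 1 - k)))"
    unfolding polylog_ext_sum_def sum_distrib_left by (intro sum.cong) auto
  show ?thesis
    unfolding multicos_exponent_def coefficient minus_mult_left[symmetric] sum by simp
qed

definition multicos_real_summand :: "nat \<Rightarrow> real \<Rightarrow> nat \<Rightarrow> real" where
  "multicos_real_summand r x k =
     (pi * x) ^ k / fact k * Re (polylog (r - k) (- cis (- (pi * x))) / \<i> ^ (r - 1 - k))"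

lemma Re_multicos_exponent_of_real:
  fixes x :: real
  assumes "\<bar>x\<bar> < 1" "r > 0"
  defines "c \<equiv> fact (r - 1) / (2 * pi) ^ (r - 1)"
  shows "Re (multicos_exponent (of_real pi * \<i>) r (of_real x)) =
    (x / 2) ^ (r - 1) * ln (2 * cos (pi * x / 2))
    - c * (\<Sum>k<r-1. multicos_real_summand r x k) - c * zetaE r * Re (1 / \<i> ^ (r - 1))"
proof -
  define summand where "summand k = c * (pi * x) ^ k / fact k *
    Re (polylog_ext (r - k) (- cis (- (pi * x))) / \<i> ^ (r - 1 - k))" for k
  have Re_mult: "Re (of_real a * z) = a * Re z" for a z
    by simp
  have "Re (multicos_exponent (of_real pi * \<i>) r (of_real x)) =
      - (\<Sum>k<r. summand k) - c * zetaE r * Re (1 / \<i> ^ (r - 1))"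
    unfolding multicos_exponent_of_real[OF assms(2)] summand_def c_def
    by (simp only: plus_complex.sel minus_complex.sel uminus_complex.sel Re_sum Re_mult) simp
  also have "(\<Sum>k<r. summand k) = (\<Sum>k<r-1. summand k) + summand (r - 1)"
    using assms(2) by (cases r) auto
  also have "summand (r - 1) = - ((x / 2) ^ (r - 1) * ln (2 * cos (pi * x / 2)))"
    using Re_Ln_one_plus_cis[OF assms(1)] assms(2)
    by (simp add: summand_def c_def polylog_ext_def power_mult_distrib power_divide)
  also have "(\<Sum>k<r-1. summand k) = c * (\<Sum>k<r-1. multicos_real_summand r x k)"
    unfolding sum_distrib_left
    by (rule sum.cong) (auto simp: summand_def multicos_real_summand_def polylog_ext_def)
  finally show ?thesis by simp
qed

lemma multicos_of_real:
  fixes x :: real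
  assumes "\<bar>x\<bar> < 1" "r \<ge> 2"
  defines "c \<equiv> fact (r - 1) / (2 * pi) ^ (r - 1)"
  shows "multicos r (of_real x / 2) = of_real ((2 * cos (pi * x / 2)) powr ((x / 2) ^ (r - 1)) *
    exp (- c * (\<Sum>k<r-1. multicos_real_summand r x k) - c * zetaE r * Re (1 / \<i> ^ (r - 1))))"
proof -
  have "cnj (log_multicos r (of_real x / 2)) = log_multicos r (of_real x / 2)"
    using assms(1,2) by (subst cnj_log_multicos) (auto simp: slit_half_plane_def)
  then have "log_multicos r (of_real x / 2) = of_real (Re (log_multicos r (of_real x / 2)))"
    by (simp add: complex_eq_iff)
  moreover have "Re (log_multicos r (of_real x / 2)) = (x / 2) ^ (r - 1) * ln (2 * cos (pi * x / 2)) +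
      (- c * (\<Sum>k<r-1. multicos_real_summand r x k) - c * zetaE r * Re (1 / \<i> ^ (r - 1)))"
    using Re_multicos_exponent_of_real[OF assms(1), of r] log_multicos_eq_exponent[of r "of_real x"] assms(1,2)
    by (simp add: c_def slit_half_plane_def)
  ultimately have "multicos r (of_real x / 2) = of_real (exp ((x / 2) ^ (r - 1) * ln (2 * cos (pi * x / 2)) +
      (- c * (\<Sum>k<r-1. multicos_real_summand r x k) - c * zetaE r * Re (1 / \<i> ^ (r - 1)))))"
    unfolding multicos_eq_exp by (metis exp_of_real)
  then show ?thesis
    using cos_pi_times_half_pos[OF assms(1)] by (simp only: exp_add powr_def) simp
qed

lemma minus_one_power_half_diff:
  assumes "k < r"
  shows "(-1) ^ ((r - 1 - k) div 2) =
    (if even r \<or> odd k then -1 else 1 :: real) * (-1) ^ (r div 2) * (-1) ^ (k div 2)"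
proof -
  obtain d where r_eq: "r = Suc (k + d)"
    using assms less_iff_Suc_add by auto
  have "r div 2 = d div 2 + k div 2 + (if even r \<or> odd k then 1 else 0)"
    unfolding r_eq by (cases "even k"; cases "even d") (auto elim!: evenE oddE)
  moreover have "r - 1 - k = d"
    by (simp add: r_eq)
  ultimately show ?thesis
    by (simp only: power_add) simp
qed

lemma multicos_real_summand_eq:
  assumes "k < r - 1"
  shows "multicos_real_summand r x k =
    (-1) ^ (r div 2) * ((if even r \<and> odd k then -1 else 1) * ((-1) ^ (k div 2) * (pi * x) ^ k / fact k *
      (if even r \<longleftrightarrow> odd k then alternating_cos_series (r - k) x else alternating_sin_series (r - k) x)))"
proof -
  have "even (r - 1 - k) \<longleftrightarrow> (even r \<longleftrightarrow> odd k)"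
    using assms by auto
  then show ?thesis
    using assms minus_one_power_half_diff[of k r]
    by (simp add: multicos_real_summand_def Re_divide_i_power polylog_minus_cis)
qed

lemma sum_lessThan_split_parity:
  fixes f :: "nat \<Rightarrow> 'a::comm_monoid_add"
  shows "(\<Sum>k<n. f k) = (\<Sum>k | k < n \<and> even k. f k) + (\<Sum>k | k < n \<and> odd k. f k)"
  by (subst sum.union_disjoint[symmetric]) (auto intro: sum.cong)

lemma odd_diff_1_div_2: "odd (k::nat) \<Longrightarrow> (k - 1) div 2 = k div 2"
  by (auto elim: oddE)

lemma multicos_of_real_even:
  fixes x :: real
  assumes "\<bar>x\<bar> < 1" "r \<ge> 2" "even r"
  shows "multicos r (of_real x / 2) = of_real (
    (2 * cos (pi * x / 2)) powr ((x / 2) ^ (r - 1)) *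
    exp ((-1) ^ (r div 2) * fact (r - 1) / (2 * pi) ^ (r - 1) *
           (\<Sum>k\<in>{k. 1 \<le> k \<and> k + 3 \<le> r \<and> odd k}.
              (-1) ^ ((k - 1) div 2) * (pi * x) ^ k / fact k * alternating_cos_series (r - k) x)
         - (-1) ^ (r div 2) * fact (r - 1) / (2 * pi) ^ (r - 1) *
           (\<Sum>k\<in>{k. k + 2 \<le> r \<and> even k}.
              (-1) ^ (k div 2) * (pi * x) ^ k / fact k * alternating_sin_series (r - k) x)))"
    (is "_ = of_real (_ * exp (_ * ?C - _ * ?S))")
proof -
  have odd: "{k. k < r - 1 \<and> odd k} = {k. 1 \<le> k \<and> k + 3 \<le> r \<and> odd k}"
    using assms(2,3) by (auto simp: odd_pos Suc_leI) presburger
  have even: "{k. k < r - 1 \<and> even k} = {k. k + 2 \<le> r \<and> even k}"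
    using assms(2) by auto
  have "(\<Sum>k | k < r - 1 \<and> odd k. multicos_real_summand r x k) = - ((-1) ^ (r div 2)) * ?C"
    unfolding odd[symmetric] sum_distrib_left
    using assms(3) by (intro sum.cong)
      (auto simp: multicos_real_summand_eq odd_diff_1_div_2[unfolded One_nat_def])
  moreover have "(\<Sum>k | k < r - 1 \<and> even k. multicos_real_summand r x k) = (-1) ^ (r div 2) * ?S"
    unfolding even[symmetric] sum_distrib_left
    using assms(3) by (intro sum.cong) (auto simp: multicos_real_summand_eq)
  moreover have "Re (1 / \<i> ^ (r - 1)) = 0"
    using assms(2,3) by (simp add: Re_divide_i_power)
  ultimately show ?thesis
    unfolding multicos_of_real[OF assms(1,2)] sum_lessThan_split_parity[of _ "r - 1"]
    by (simp only:) (simp add: algebra_simps)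
qed

lemma multicos_of_real_odd:
  fixes x :: real
  assumes "\<bar>x\<bar> < 1" "r \<ge> 2" "odd r"
  shows "multicos r (of_real x / 2) = of_real (
    (2 * cos (pi * x / 2)) powr ((x / 2) ^ (r - 1)) *
    exp (- ((-1) ^ ((r - 1) div 2)) * fact (r - 1) / (2 * pi) ^ (r - 1) *
           (\<Sum>k\<in>{k. k + 3 \<le> r \<and> even k}.
              (-1) ^ (k div 2) * (pi * x) ^ k / fact k * alternating_cos_series (r - k) x)
         - (-1) ^ ((r - 1) div 2) * fact (r - 1) / (2 * pi) ^ (r - 1) *
           (\<Sum>k\<in>{k. 1 \<le> k \<and> k + 2 \<le> r \<and> odd k}.
              (-1) ^ ((k - 1) div 2) * (pi * x) ^ k / fact k * alternating_sin_series (r - k) x)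
         - (-1) ^ ((r - 1) div 2) * fact (r - 1) / (2 * pi) ^ (r - 1) * zetaE r))"
    (is "_ = of_real (_ * exp (_ * ?C - _ * ?S - _))")
proof -
  have even: "{k. k < r - 1 \<and> even k} = {k. k + 3 \<le> r \<and> even k}"
    using assms(3) by auto presburger
  have odd: "{k. k < r - 1 \<and> odd k} = {k. 1 \<le> k \<and> k + 2 \<le> r \<and> odd k}"
    by (auto simp: odd_pos Suc_leI)
  have "(\<Sum>k | k < r - 1 \<and> even k. multicos_real_summand r x k) = (-1) ^ (r div 2) * ?C"
    unfolding even[symmetric] sum_distrib_left
    using assms(3) by (intro sum.cong) (auto simp: multicos_real_summand_eq)
  moreover have "(\<Sum>k | k < r - 1 \<and> odd k. multicos_real_summand r x k) = (-1) ^ (r div 2) * ?S"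
    unfolding odd[symmetric] sum_distrib_left
    using assms(3) by (intro sum.cong)
      (auto simp: multicos_real_summand_eq odd_diff_1_div_2[unfolded One_nat_def])
  moreover have "Re (1 / \<i> ^ (r - 1)) = (-1) ^ (r div 2)"
    unfolding Re_divide_i_power odd_diff_1_div_2[OF assms(3)] using assms(3) by simp
  ultimately show ?thesis
    unfolding multicos_of_real[OF assms(1,2)] sum_lessThan_split_parity[of _ "r - 1"]
      odd_diff_1_div_2[OF assms(3)]
    by (simp only:) (simp add: algebra_simps)
qed

theorem theorem2p11:
  fixes r :: nat
  assumes "r \<ge> 2"
  shows
   "(\<forall>x::complex. Im x < 0 \<longrightarrow>
      multicos r (x / 2) = exp (
        - (of_nat (fact (r - 1)) / (2 * of_real pi * \<i>) ^ (r - 1)) *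
          (\<Sum>k=0..r-1. (of_real pi * \<i>) ^ k / of_nat (fact k) *
              polylog (r - k) (- exp (- of_real pi * \<i> * x)) * x ^ k)
        + of_real pi * \<i> / of_nat r * (x / 2) ^ r
        - of_nat (fact (r - 1)) / (2 * of_real pi * \<i>) ^ (r - 1) * of_real (zetaE r)))
  \<and> (\<forall>x::complex. Im x > 0 \<longrightarrow>
      multicos r (x / 2) = exp (
        - (of_nat (fact (r - 1)) / (- 2 * of_real pi * \<i>) ^ (r - 1)) *
          (\<Sum>k=0..r-1. (- of_real pi * \<i>) ^ k / of_nat (fact k) *
              polylog (r - k) (- exp (of_real pi * \<i> * x)) * x ^ k)
        - of_real pi * \<i> / of_nat r * (x / 2) ^ r
        - of_nat (fact (r - 1)) / (- 2 * of_real pi * \<i>) ^ (r - 1) * of_real (zetaE r)))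
  \<and> (even r \<longrightarrow> (\<forall>x::real. 0 \<le> x \<and> x < 1 \<longrightarrow>
      multicos r (of_real x / 2) = of_real (
        (2 * cos (pi * x / 2)) powr ((x / 2) ^ (r - 1)) *
        exp ( (-1) ^ (r div 2) * fact (r - 1) / (2 * pi) ^ (r - 1) *
               (\<Sum>k\<in>{k. 1 \<le> k \<and> k + 3 \<le> r \<and> odd k}.
                  (-1) ^ ((k - 1) div 2) * (pi * x) ^ k / fact k *
                  (\<Sum>n. (-1) ^ (n+1) * cos (pi * real (n+1) * x) / real (n+1) ^ (r - k)))
             - (-1) ^ (r div 2) * fact (r - 1) / (2 * pi) ^ (r - 1) *
               (\<Sum>k\<in>{k. k + 2 \<le> r \<and> even k}.
                  (-1) ^ (k div 2) * (pi * x) ^ k / fact k *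
                  (\<Sum>n. (-1) ^ (n+1) * sin (pi * real (n+1) * x) / real (n+1) ^ (r - k)))))))
  \<and> (odd r \<longrightarrow> (\<forall>x::real. 0 \<le> x \<and> x < 1 \<longrightarrow>
      multicos r (of_real x / 2) = of_real (
        (2 * cos (pi * x / 2)) powr ((x / 2) ^ (r - 1)) *
        exp ( - ((-1) ^ ((r - 1) div 2)) * fact (r - 1) / (2 * pi) ^ (r - 1) *
               (\<Sum>k\<in>{k. k + 3 \<le> r \<and> even k}.
                  (-1) ^ (k div 2) * (pi * x) ^ k / fact k *
                  (\<Sum>n. (-1) ^ (n+1) * cos (pi * real (n+1) * x) / real (n+1) ^ (r - k)))
             - (-1) ^ ((r - 1) div 2) * fact (r - 1) / (2 * pi) ^ (r - 1) *
               (\<Sum>k\<in>{k. 1 \<le> k \<and> k + 2 \<le> r \<and> odd k}.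
                  (-1) ^ ((k - 1) div 2) * (pi * x) ^ k / fact k *
                  (\<Sum>n. (-1) ^ (n+1) * sin (pi * real (n+1) * x) / real (n+1) ^ (r - k)))
             - (-1) ^ ((r - 1) div 2) * fact (r - 1) / (2 * pi) ^ (r - 1) * zetaE r))))"
proof (intro conjI allI impI, goal_cases)
  case (1 x)
  then have "norm (exp (- (of_real pi * \<i>) * x)) < 1"
    by (simp add: mult_pos_neg)
  with multicos_lower_half_plane[OF assms 1] show ?case
    using assms by (simp add: multicos_exponent_eq_polylog mult.assoc)
next
  case (2 x)
  then have "norm (exp (- (- (of_real pi * \<i>)) * x)) < 1"
    by (simp add: mult_pos_neg)
  with multicos_upper_half_plane[OF assms 2] show ?case
    using assms by (simp add: multicos_exponent_eq_polylog mult.assoc)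
next
  case (3 x)
  then show ?case
    using multicos_of_real_even[of x r] assms
    by (simp add: alternating_cos_series_def alternating_sin_series_def)
next
  case (4 x)
  then show ?case
    using multicos_of_real_odd[of x r] assms
    by (simp add: alternating_cos_series_def alternating_sin_series_def)
qed

end
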